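(* Let $n$ be a positive integer with $n\equiv 1\pmod 8$. If $n\ge 737$, then a $2$-free $1$-partition of $n$ exists. If $n\ge 3609$, then a $\{3,5,7\}$-full $1$-partition of $n$ exists.
   Context: For a positive integer $n$, a $1$-partition of $n$ is a finite set $\{a_1,\ldots,a_r\}$ of distinct positive integers with $a_1+\cdots+a_r=n$ and $\frac1{a_1}+\cdots+\frac1{a_r}=1$. It is $2$-free if none of the $a_i$ is divisible by $2$. For a set $P$ of primes, it is $P$-full if all prime factors of all the $a_i$ are contained in $P$ (not every prime of $P$ need occur). *)

theory Defs
  imports Complex_Main "HOL-Number_Theory.Cong" "HOL-Computational_Algebra.Primes"
begin

definition one_partition :: "nat \<Rightarrow> nat set \<Rightarrow> bool" where
  "one_partition n A \<longleftrightarrow>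
     finite A \<and> (\<forall>a\<in>A. a > 0) \<and> (\<Sum>a\<in>A. a) = n \<and> (\<Sum>a\<in>A. 1 / rat_of_nat a) = 1"

definition two_free :: "nat set \<Rightarrow> bool" where
  "two_free A \<longleftrightarrow> (\<forall>a\<in>A. \<not> 2 dvd a)"

(* Not every element of P has to occur as a prime factor.
   The set P is meant to consist of primes. *)
definition prime_full :: "nat set \<Rightarrow> nat set \<Rightarrow> bool" where
  "prime_full P A \<longleftrightarrow> (\<forall>a\<in>A. prime_factors a \<subseteq> P)"

end

theory Submission
  imports Defs "HOL-Library.Code_Binary_Nat"
begin

text \<open>
  The proof combines a recursion with a finite table.

  If \<open>A\<close> is a 1-partition of \<open>n\<close>, then \<open>7 A\<close> has reciprocal sum \<open>1 / 7\<close>, and adding a disjoint set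
  \<open>B\<close> with reciprocal sum \<open>6 / 7\<close> gives a 1-partition of \<open>7 n + \<Sum>B\<close>. All members of \<open>B\<close> other than 7
  and \<open>315 = 7 * 45\<close> can be taken to have no prime factors besides 3 and 5, so that \<open>B\<close> is disjoint
  from \<open>7 A\<close> as soon as \<open>A\<close> avoids 1 and 45; and then \<open>7 A \<union> B\<close> avoids 1 and 45 as well. There are
  seven such sets \<open>B\<close> whose sums, the largest being 7610, fit all residue classes modulo 7
  (\<open>extendable_completion\<close>, \<open>descent_by_seven\<close>). Hence the existence of \<open>{3, 5, 7}\<close>-full 1-partitions
  avoiding 1 and 45 for all \<open>n \<equiv> 1 (mod 8)\<close> with \<open>3609 \<le> n < 7 * 3609 + 7610 = 32873\<close> implies it for all
  larger \<open>n\<close>, and such partitions consist of odd numbers. Finitely many 2-free 1-partitions settle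
  \<open>737 \<le> n < 3609\<close>.

  The finite part concerns more than four thousand values of \<open>n\<close>. It is compressed by grids: if
  the sets \<open>X\<^sub>1, ..., X\<^sub>k\<close> lie in some \<open>U\<close> and have the same reciprocal sum \<open>\<rho>\<close>, while \<open>Y\<^sub>1, ..., Y\<^sub>l\<close> avoid
  \<open>U\<close> and have reciprocal sum \<open>1 - \<rho>\<close>, then all \<open>X\<^sub>i \<union> Y\<^sub>j\<close> are 1-partitions. A handful of grids reaches
  almost every value, and fewer than a hundred single partitions fill the gaps. The sets come from a
  dynamic programme over the pairs of partial reciprocal sum and partial sum.
\<close>

section \<open>Certificates for sums of unit fractions\<close>

definition recip_sum :: "nat set \<Rightarrow> rat" where
  "recip_sum A = (\<Sum>a\<in>A. 1 / rat_of_nat a)"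

definition cofactors :: "nat \<Rightarrow> nat list \<Rightarrow> (nat \<times> nat) list" where
  "cofactors L D = map (\<lambda>a. (a, L div a)) D"

text \<open>
  Over a common denominator \<open>L\<close> the fraction \<open>1 / a\<close> has numerator \<open>L div a\<close>. Walking along
  a fixed table of divisors of \<open>L\<close> yields the numerator of the whole sum and, because every table
  entry is passed only once, also shows that the denominators are distinct members of the table.
  All divisions are done once per table, so that certificates are checked by comparisons and
  additions alone.
\<close>

fun cofactor_sum :: "(nat \<times> nat) list \<Rightarrow> nat list \<Rightarrow> nat option" where
  "cofactor_sum E [] = Some 0"
| "cofactor_sum [] (x # xs) = None"
| "cofactor_sum ((a, c) # E) (x # xs) =
     (if x = a then map_option ((+) c) (cofactor_sum E xs) else cofactor_sum E (x # xs))"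

definition divisor_table :: "nat \<Rightarrow> nat list \<Rightarrow> bool" where
  "divisor_table L D \<longleftrightarrow> L > 0 \<and> distinct D \<and> list_all (\<lambda>a. a dvd L) D"

lemma divisor_table_filter: "divisor_table L D \<Longrightarrow> divisor_table L (filter P D)"
  by (auto simp: divisor_table_def list_all_iff)

lemma cofactor_sum_correct:
  assumes "cofactor_sum (cofactors L D) xs = Some t" "divisor_table L D"
  shows "distinct xs \<and> set xs \<subseteq> set D \<and> recip_sum (set xs) = rat_of_nat t / rat_of_nat L"
  using assms
proof (induction "cofactors L D" xs arbitrary: D t rule: cofactor_sum.induct)
  case (1 E)
  then show ?case by (simp add: recip_sum_def)
next
  case (2 x xs)
  then show ?case by (simp flip: 2(1))
next
  case (3 a c E x xs)
  from 3(3) obtain D' where D: "D = a # D'" "c = L div a" "E = cofactors L D'"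
    by (auto simp: cofactors_def Cons_eq_map_conv)
  have tab: "divisor_table L D'" and a: "a \<notin> set D'" "a dvd L" "L > 0"
    using 3(5) D by (auto simp: divisor_table_def)
  show ?case
  proof (cases "x = a")
    case True
    with 3(4) 3(3)[symmetric] D obtain t'
      where t': "cofactor_sum (cofactors L D') xs = Some t'" "t = c + t'"
      by (auto simp: cofactors_def)
    have IH: "distinct xs \<and> set xs \<subseteq> set D' \<and> recip_sum (set xs) = rat_of_nat t' / rat_of_nat L"
      using 3(1)[OF True D(3)] t' tab D by simp
    have "a \<notin> set xs" using IH a by auto
    moreover have "rat_of_nat c / rat_of_nat L = 1 / rat_of_nat a"
      using a D by (auto simp: field_simps simp flip: of_nat_mult)
    ultimately show ?thesis
      using IH t' True D by (auto simp: recip_sum_def add_divide_distrib)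
  next
    case False
    with 3 D tab show ?thesis
      using 3(2)[OF False D(3)] by (auto simp: cofactors_def)
  qed
qed


section \<open>Grids of 1-partitions\<close>

text \<open>
  A grid \<open>(U, r, Xs, Ys)\<close> stores 1-partitions economically. The sets in \<open>Xs\<close> lie inside \<open>U\<close> and
  have reciprocal sum \<open>r / L\<close>; those in \<open>Ys\<close> avoid \<open>U\<close> and have reciprocal sum \<open>1 - r / L\<close>.
  Every union of a set from \<open>Xs\<close> with a set from \<open>Ys\<close> is then a 1-partition, so a grid with \<open>k\<close>
  sets on either side accounts for up to \<open>k\<^sup>2\<close> integers.
\<close>

type_synonym grid = "nat list \<times> nat \<times> nat list list \<times> nat list list"

text \<open>
  A constant of its own, in order that evaluation by rewriting normalises the table \<open>E\<close> only once and not
  for every member of the list.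
\<close>

definition all_have_cofactor_sum :: "(nat \<times> nat) list \<Rightarrow> nat \<Rightarrow> nat list list \<Rightarrow> bool" where
  "all_have_cofactor_sum E t xss \<longleftrightarrow> list_all (\<lambda>xs. cofactor_sum E xs = Some t) xss"

fun grid_ok :: "nat \<Rightarrow> nat list \<Rightarrow> grid \<Rightarrow> bool" where
  "grid_ok L D (U, r, Xs, Ys) \<longleftrightarrow> r \<le> L \<and>
     all_have_cofactor_sum (cofactors L (filter (\<lambda>a. a \<in> set U) D)) r Xs \<and>
     all_have_cofactor_sum (cofactors L (filter (\<lambda>a. a \<notin> set U) D)) (L - r) Ys"

lemma grid_partition:
  assumes D: "divisor_table L D" and grid: "grid_ok L D (U, r, Xs, Ys)"
    and "xs \<in> set Xs" "ys \<in> set Ys"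
  shows "one_partition (sum_list xs + sum_list ys) (set xs \<union> set ys)"
    and "set xs \<union> set ys \<subseteq> set D"
proof -
  have x: "cofactor_sum (cofactors L (filter (\<lambda>a. a \<in> set U) D)) xs = Some r"
    and y: "cofactor_sum (cofactors L (filter (\<lambda>a. a \<notin> set U) D)) ys = Some (L - r)"
    and r: "r \<le> L"
    using assms by (auto simp: list_all_iff all_have_cofactor_sum_def)
  have L: "L > 0" "\<forall>a\<in>set D. a > 0"
    using D by (auto simp: divisor_table_def list_all_iff dest: dvd_pos_nat)
  have X: "distinct xs" "set xs \<subseteq> set (filter (\<lambda>a. a \<in> set U) D)"
      "recip_sum (set xs) = rat_of_nat r / rat_of_nat L"
    using cofactor_sum_correct[OF x divisor_table_filter[OF D]] by auto
  have Y: "distinct ys" "set ys \<subseteq> set (filter (\<lambda>a. a \<notin> set U) D)"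
      "recip_sum (set ys) = rat_of_nat (L - r) / rat_of_nat L"
    using cofactor_sum_correct[OF y divisor_table_filter[OF D]] by auto
  have disj: "set xs \<inter> set ys = {}" using X Y by auto
  have "recip_sum (set xs \<union> set ys) = 1"
    using X Y disj L r
    by (simp add: recip_sum_def sum.union_disjoint of_nat_diff diff_divide_distrib)
  moreover have "\<Sum>(set xs \<union> set ys) = sum_list xs + sum_list ys"
    using X Y disj by (simp add: sum.union_disjoint distinct_sum_list_conv_Sum)
  moreover show "set xs \<union> set ys \<subseteq> set D" using X Y by auto
  ultimately show "one_partition (sum_list xs + sum_list ys) (set xs \<union> set ys)"
    using L by (auto simp: one_partition_def recip_sum_def)
qed


section \<open>Collecting the sums of grids\<close>

text \<open>
  The sums of all grids are collected in a binary trie, in which a number is found by reading its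
  binary digits from the least significant one. Inserting a number touches one path only, unions
  are computed structurally, and fullness on an interval is decided by one traversal. Each rewrite
  step thus deals with a small term, which keeps the evaluation of thousands of sums cheap.
\<close>

datatype trie = Leaf | Node bool trie trie

fun trie_mem :: "num \<Rightarrow> trie \<Rightarrow> bool" where
  "trie_mem k Leaf = False"
| "trie_mem num.One (Node b l r) = b"
| "trie_mem (num.Bit0 k) (Node b l r) = trie_mem k l"
| "trie_mem (num.Bit1 k) (Node b l r) = trie_mem k r"

fun trie_insert :: "num \<Rightarrow> trie \<Rightarrow> trie" where
  "trie_insert num.One Leaf = Node True Leaf Leaf"
| "trie_insert num.One (Node b l r) = Node True l r"
| "trie_insert (num.Bit0 k) Leaf = Node False (trie_insert k Leaf) Leaf"
| "trie_insert (num.Bit0 k) (Node b l r) = Node b (trie_insert k l) r"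
| "trie_insert (num.Bit1 k) Leaf = Node False Leaf (trie_insert k Leaf)"
| "trie_insert (num.Bit1 k) (Node b l r) = Node b l (trie_insert k r)"

lemma trie_mem_insert [simp]: "trie_mem k (trie_insert m t) \<longleftrightarrow> k = m \<or> trie_mem k t"
proof (induction m arbitrary: k t)
  case One
  show ?case by (cases t; cases k) auto
next
  case (Bit0 m)
  then show ?case by (cases t; cases k) auto
next
  case (Bit1 m)
  then show ?case by (cases t; cases k) auto
qed

fun trie_union :: "trie \<Rightarrow> trie \<Rightarrow> trie" where
  "trie_union Leaf t = t"
| "trie_union t Leaf = t"
| "trie_union (Node a l r) (Node b l' r') = Node (a \<or> b) (trie_union l l') (trie_union r r')"

lemma trie_mem_union [simp]: "trie_mem k (trie_union s t) \<longleftrightarrow> trie_mem k s \<or> trie_mem k t"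
proof (induction s t arbitrary: k rule: trie_union.induct)
  case (3 a l r b l' r')
  then show ?case by (cases k) auto
qed auto

text \<open>
  Unions are formed along a balanced tree, so that most of them involve small tries.
\<close>

fun trie_union_pairs :: "trie list \<Rightarrow> trie list" where
  "trie_union_pairs (s # t # ts) = trie_union s t # trie_union_pairs ts"
| "trie_union_pairs ts = ts"

lemma trie_mem_union_pairs [simp]:
  "(\<exists>t\<in>set (trie_union_pairs ts). trie_mem k t) \<longleftrightarrow> (\<exists>t\<in>set ts. trie_mem k t)"
  by (induction ts rule: trie_union_pairs.induct) auto

text \<open>
  Each round halves the number of tries, so the rounds counted by the list \<open>ts\<close> leave at most one.
\<close>

definition trie_union_all :: "trie list \<Rightarrow> trie" where
  "trie_union_all ts = foldr trie_union (fold (\<lambda>_. trie_union_pairs) ts ts) Leaf"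

lemma trie_mem_union_all: "trie_mem k (trie_union_all ts) \<longleftrightarrow> (\<exists>t\<in>set ts. trie_mem k t)"
proof -
  have "trie_mem k (foldr trie_union us Leaf) \<longleftrightarrow> (\<exists>t\<in>set us. trie_mem k t)" for us
    by (induction us) auto
  moreover have "(\<exists>t\<in>set (fold (\<lambda>_. trie_union_pairs) us ts). trie_mem k t) \<longleftrightarrow> (\<exists>t\<in>set ts. trie_mem k t)"
    for us :: "trie list"
    by (induction us arbitrary: ts) simp_all
  ultimately show ?thesis by (simp add: trie_union_all_def)
qed

definition trie_of :: "nat list \<Rightarrow> trie" where
  "trie_of ns = foldr (\<lambda>n. trie_insert (num_of_nat n)) ns Leaf"

lemma trie_mem_of: "trie_mem k (trie_of ns) \<longleftrightarrow> k \<in> num_of_nat ` set ns"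
  by (induction ns) (auto simp: trie_of_def)

definition sum_tries :: "nat list \<Rightarrow> nat list \<Rightarrow> trie list" where
  "sum_tries xs ys = map (\<lambda>x. trie_of (map ((+) x) ys)) xs"

fun grid_tries :: "grid \<Rightarrow> trie list" where
  "grid_tries (U, r, Xs, Ys) = sum_tries (map sum_list Xs) (map sum_list Ys)"

definition grids_trie :: "grid list \<Rightarrow> trie" where
  "grids_trie gs = trie_union_all (concat (map grid_tries gs))"

lemma grids_trie_partition:
  assumes D: "divisor_table L D" and grids: "list_all (grid_ok L D) gs"
    and mem: "trie_mem (num_of_nat n) (grids_trie gs)" and n: "n > 1"
  obtains A where "one_partition n A" "A \<subseteq> set D"
proof -
  from mem obtain g t where g: "g \<in> set gs" "t \<in> set (grid_tries g)" "trie_mem (num_of_nat n) t"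
    by (auto simp: grids_trie_def trie_mem_union_all)
  obtain U r Xs Ys where g_eq: "g = (U, r, Xs, Ys)" by (cases g)
  from g(2,3) obtain xs ys where xy: "xs \<in> set Xs" "ys \<in> set Ys"
      and eq: "num_of_nat n = num_of_nat (sum_list xs + sum_list ys)"
    unfolding g_eq by (auto simp: sum_tries_def trie_mem_of)
  (* num_of_nat sends 0 to 1 as well, hence the assumption n > 1 *)
  have "n = sum_list xs + sum_list ys"
  proof (cases "sum_list xs + sum_list ys = 0")
    case True
    with eq have "num_of_nat n = num_of_nat 1" by simp
    with n have "n = 1" by (metis num_of_nat_inverse less_trans zero_less_one)
    with n show ?thesis by simp
  next
    case False
    with eq n show ?thesis by (metis num_of_nat_inverse less_trans zero_less_one not_gr_zero)
  qed
  moreover have "grid_ok L D (U, r, Xs, Ys)"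
    using grids g(1) unfolding g_eq by (auto simp: list_all_iff)
  ultimately show thesis
    using grid_partition[OF D _ xy] that[of "set xs \<union> set ys"] by simp
qed

text \<open>
  An interval lies in a trie if its even and its odd members, halved, lie in the two branches.
\<close>

fun trie_interval :: "nat \<Rightarrow> nat \<Rightarrow> trie \<Rightarrow> bool" where
  "trie_interval a b Leaf \<longleftrightarrow> b \<le> a \<or> b \<le> 1"
| "trie_interval a b (Node f l r) \<longleftrightarrow> (f \<or> 1 < a \<or> b \<le> 1) \<and>
     trie_interval (Suc a div 2) (Suc b div 2) l \<and> trie_interval (a div 2) (b div 2) r"

lemma trie_interval_imp_mem:
  "trie_interval a b t \<Longrightarrow> a \<le> nat_of_num k \<Longrightarrow> nat_of_num k < b \<Longrightarrow> trie_mem k t"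
proof (induction t arbitrary: a b k)
  case Leaf
  have "nat_of_num k > 0" by (rule nat_of_num_pos)
  with Leaf show ?case by auto
next
  case (Node f l r)
  show ?case
  proof (cases k)
    case One
    with Node.prems show ?thesis by auto
  next
    case (Bit0 m)
    have "Suc a div 2 \<le> nat_of_num m" "nat_of_num m < Suc b div 2"
      using Node.prems(2,3) Bit0 by auto
    with Node Bit0 show ?thesis by auto
  next
    case (Bit1 m)
    have "a div 2 \<le> nat_of_num m" "nat_of_num m < b div 2"
      using Node.prems(2,3) Bit1 by auto
    with Node Bit1 show ?thesis by auto
  qed
qed

fun even_branch :: "trie \<Rightarrow> trie" where
  "even_branch Leaf = Leaf"
| "even_branch (Node b l r) = l"

fun odd_branch :: "trie \<Rightarrow> trie" where
  "odd_branch Leaf = Leaf"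
| "odd_branch (Node b l r) = r"

lemma trie_mem_even_branch: "trie_mem k (even_branch t) \<longleftrightarrow> trie_mem (num.Bit0 k) t"
  by (cases t) auto

lemma trie_mem_odd_branch: "trie_mem k (odd_branch t) \<longleftrightarrow> trie_mem (num.Bit1 k) t"
  by (cases t) auto

text \<open>
  Modulo 8 every odd \<open>a\<close> is its own inverse, so a 1-partition into odd parts has a sum congruent
  to 1. Only the branch of the numbers \<open>8 m + 1\<close> can be full.
\<close>

definition covers_1_mod_8 :: "nat \<Rightarrow> nat \<Rightarrow> trie \<Rightarrow> bool" where
  "covers_1_mod_8 a b t \<longleftrightarrow> trie_interval a b (even_branch (even_branch (odd_branch t)))"

lemma partition_from_grids:
  assumes D: "divisor_table L D" and grids: "list_all (grid_ok L D) gs"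
    and covers: "covers_1_mod_8 a b (grids_trie gs)"
    and n: "n mod 8 = 1" "8 * a < n" "n \<le> 8 * b" "n > 1"
  obtains A where "one_partition n A" "A \<subseteq> set D"
proof -
  define m k where "m = n div 8" and "k = num_of_nat m"
  have m: "n = 8 * m + 1"
    using n(1) mult_div_mod_eq[of 8 n] by (simp add: m_def)
  then have k: "nat_of_num k = m" using n(4) by (simp add: k_def num_of_nat_inverse)
  have "a \<le> m" "m < b" using m n(2,3) by auto
  then have "trie_mem k (even_branch (even_branch (odd_branch (grids_trie gs))))"
    using covers k by (intro trie_interval_imp_mem[of a b]) (simp_all add: covers_1_mod_8_def)
  then have "trie_mem (num.Bit1 (num.Bit0 (num.Bit0 k))) (grids_trie gs)"
    by (simp add: trie_mem_even_branch trie_mem_odd_branch)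
  moreover have "nat_of_num (num.Bit1 (num.Bit0 (num.Bit0 k))) = n"
    using k m by simp
  then have "num.Bit1 (num.Bit0 (num.Bit0 k)) = num_of_nat n"
    by (metis nat_of_num_inverse)
  ultimately have "trie_mem (num_of_nat n) (grids_trie gs)" by simp
  from grids_trie_partition[OF D grids this n(4)]
  obtain A where "one_partition n A" "A \<subseteq> set D" .
  then show thesis by (rule that)
qed


section \<open>Odd parts: the range below 3609\<close>

definition odd_divisors :: "nat list" where
  "odd_divisors =
    [3, 5, 7, 9, 11, 13, 15, 19, 21, 25, 27, 33, 35, 39, 45, 55, 57, 63, 65, 75, 77, 91, 95, 99, 105, 117, 135, 143,
    165, 171, 175, 189, 195, 225, 231, 247, 273, 275, 297, 315, 325, 351, 385, 429, 455, 495, 525, 585, 675, 693, 819,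
    825, 975, 1001, 1155]"

definition grid_odd_1 :: grid where
  "grid_odd_1 = (
    [3, 5, 7, 9, 11, 13, 15, 25, 33, 39, 45, 63, 65, 91, 105, 117, 195, 225, 273, 275, 315, 325, 429, 455, 525, 585,
    1155],
    11826360,
   [
    [3,5,7,11,15,33,39,65,91,195], [3,5,9,11,13,25,33,39,117,225], [3,5,7,9,11,33,105,315],
    [3,5,7,11,13,33,45,91,117,195], [3,5,9,11,15,25,33,65,91,105,117,225], [3,5,9,11,13,25,33,91,105,117,195,225],
    [3,5,7,11,13,33,39,63,315,455], [3,5,9,11,13,25,33,63,105,195,225,273], [3,5,7,11,15,39,45,65,91,195,225,275],
    [3,5,7,11,15,25,33,91,225,585], [3,7,9,11,13,15,33,39,45,63,315,455],
    [3,7,9,11,13,15,25,45,65,105,273,275,325,525], [3,5,7,11,15,25,39,91,275,325,455,525],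
    [3,7,9,11,13,25,33,39,45,65,105,117,195,225,315,585], [3,5,7,11,13,45,63,91,105,195,225,275,315,455],
    [3,7,9,11,13,15,25,45,65,91,275,325,455,525], [3,5,11,13,15,25,33,39,65,91,105,117,225,273,315,585],
    [3,5,7,11,15,33,63,91,105,117,195,315,455,585], [3,5,7,11,15,25,39,91,225,315,429,1155],
    [3,5,7,11,13,33,65,105,117,225,315,455,525,585]],
   [
    [21,55,77], [35,55,75,77,175], [21,35,385], [27,55,99,135,165], [21,55,189,231,297], [21,55,165,231,385],
    [21,75,99,175,495], [35,55,77,165,189,231,297], [35,55,75,175,189,231,297], [21,75,77,297,675],
    [27,77,99,135,189,297,385], [35,55,77,135,189,231,495], [21,55,165,175,825], [35,55,77,99,231,385,495],
    [27,75,99,135,165,297,675], [21,99,165,189,231,297,495], [27,55,135,165,189,297,693], [27,77,99,135,175,231,825],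
    [27,75,77,165,189,385,675]])"

definition grid_odd_2 :: grid where
  "grid_odd_2 = (
    [5, 13, 15, 25, 39, 45, 55, 65, 77, 91, 99, 105, 117, 143, 175, 195, 225, 275, 325, 385, 495, 525, 585, 819, 975,
    1001],
    4446000,
   [
    [5,15,25,45,77,225], [5,15,45,65,77,91,105,117], [5,15,39,65,77,91,105,195], [5,13,39,77,99,117,143,195],
    [5,13,39,77,99,105,117,385], [5,15,25,55,143,175,195,275], [5,15,25,77,91,105,225,585],
    [5,15,25,55,99,175,275,495], [5,13,39,77,105,117,225,275,385,495], [5,15,39,55,91,117,143,225,275,819],
    [5,15,39,65,77,99,143,225,325,975], [5,25,39,55,77,91,99,105,117,175,275,1001],
    [5,13,55,65,105,175,195,225,275,325,385,585], [5,13,45,65,77,117,225,325,585,975],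
    [5,15,39,55,99,175,195,225,275,325,495,585], [5,13,65,77,91,117,175,195,225,325,525,819],
    [5,15,25,91,99,143,175,275,819,1001]],
   [
    [3,9,11,21,27,33,297], [3,7,9,27,63,135,165], [3,7,11,27,33,63,297], [3,7,11,21,35,165,231],
    [3,7,9,21,135,165,189], [3,7,11,21,33,189,297], [3,7,9,33,35,231,315], [3,9,11,21,27,63,135,165,231],
    [3,9,11,27,33,35,63,297,315], [3,7,11,21,63,135,165,189,231], [3,9,11,21,33,35,189,297,315],
    [3,7,9,35,63,135,165,189,315], [3,7,9,33,35,165,693], [3,7,11,33,35,63,189,297,315],
    [3,7,9,33,63,135,189,231,315], [3,7,11,27,33,135,189,297,315], [3,9,11,21,33,35,165,231,693]])"

text \<open>
  The sums that the grids miss: with the empty set as the only left side, every right side is a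
  1-partition by itself. The prime 19 occurs for the sum 817 alone.
\<close>

definition single_odd :: grid where
  "single_odd = ([], 0, [[]],
   [
    [3,5,7,11,13,21,33,39,45,105,117,143,195], [3,5,7,11,21,33,35,39,45,55,63,65,77,91,195],
    [3,5,7,9,11,15,35,99,143,195,231], [3,5,7,9,11,21,33,45,77,165,385], [3,5,7,11,13,25,33,35,55,75,77,105,325],
    [3,5,7,11,13,21,35,39,45,75,117,175,231], [3,5,7,11,13,15,39,63,65,91,99,143,231],
    [3,5,7,11,13,33,39,55,63,65,77,91,99,105,143], [3,5,7,9,15,19,35,57,63,91,95,171,247],
    [3,5,7,9,13,25,35,39,77,105,117,165,225], [3,5,7,11,13,21,33,39,55,77,91,135,351],
    [3,5,7,13,15,21,35,39,63,65,75,91,99,143,175], [3,5,7,11,13,21,35,39,55,65,91,143,385],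
    [3,5,9,11,13,21,33,39,55,63,65,77,105,117,273], [3,5,7,11,13,15,35,39,99,117,143,195,231],
    [3,5,7,11,15,21,39,55,63,65,77,91,99,195,231], [3,5,7,11,15,33,35,39,55,63,65,77,91,195,315],
    [3,5,7,11,13,21,33,39,45,65,117,273,385], [3,5,7,11,13,21,39,63,65,75,91,99,143,175,231],
    [3,5,7,11,13,33,35,39,63,65,75,91,143,175,315], [3,5,7,11,13,33,35,39,55,63,91,99,135,165,351],
    [3,5,7,11,21,33,35,39,55,63,65,75,91,99,165,175,195], [3,5,7,11,13,21,35,39,75,99,117,143,175,195,231],
    [3,5,7,11,13,21,39,45,65,77,105,117,165,231,273],
    [5,7,9,11,13,15,21,25,27,33,35,39,55,63,65,77,91,99,135,143,225], [3,5,7,11,13,21,39,55,63,77,91,99,135,231,351],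
    [3,5,7,11,13,25,33,39,63,77,105,117,189,225,297], [3,5,7,11,13,33,35,39,55,63,77,99,143,195,455],
    [3,5,7,11,21,33,35,39,55,63,65,75,77,91,175,195,315], [3,5,7,11,13,33,35,39,75,77,91,99,143,175,195,297,351],
    [5,7,9,11,13,15,21,25,27,35,39,45,55,63,65,77,91,99,135,143,175,275,315]])"

definition grids_odd :: "grid list" where
  "grids_odd = [grid_odd_1, grid_odd_2, single_odd]"

lemma divisor_table_odd: "divisor_table 12837825 odd_divisors"
  by code_simp

lemma grids_odd_ok: "list_all (grid_ok 12837825 odd_divisors) grids_odd"
  by code_simp

lemma grids_odd_cover: "covers_1_mod_8 92 451 (grids_trie grids_odd)"
  by code_simp

lemma two_free_partition_below:
  assumes "n mod 8 = 1" "737 \<le> n" "n < 3609"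
  obtains A where "one_partition n A" "two_free A"
proof (rule partition_from_grids[OF divisor_table_odd grids_odd_ok grids_odd_cover])
  show "n mod 8 = 1" "8 * 92 < n" "n \<le> 8 * 451" "n > 1"
    using assms by simp_all
next
  fix A assume A: "one_partition n A" "A \<subseteq> set odd_divisors"
  have "\<not> 2 dvd a" if "a \<in> A" for a
  proof
    assume "2 dvd a"
    moreover have "a dvd 12837825"
      using that A(2) divisor_table_odd by (auto simp: divisor_table_def list_all_iff)
    ultimately have "2 dvd (12837825 :: nat)" by (rule dvd_trans)
    then show False by simp
  qed
  with A show thesis by (auto simp: two_free_def intro: that)
qed


section \<open>Multiplying a partition by 7\<close>

text \<open>
  \<open>extendable n A\<close> is the property that the recursion preserves; excluding 1 only discards the
  partition \<open>{1}\<close> of 1.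
\<close>

definition extendable :: "nat \<Rightarrow> nat set \<Rightarrow> bool" where
  "extendable n A \<longleftrightarrow> one_partition n A \<and> prime_full {3, 5, 7} A \<and> 1 \<notin> A \<and> 45 \<notin> A"

text \<open>
  The set \<open>7 A\<close> has reciprocal sum \<open>1 / 7\<close> and has to be completed by a set \<open>B\<close> with sum \<open>6 / 7\<close>.
  Because of the denominator 7, some elements of \<open>B\<close> must be multiples \<open>7 c\<close> of 7, and such an element
  lies outside \<open>7 A\<close> only if \<open>c \<notin> A\<close>. If 49 divides no element of \<open>B\<close>, then these \<open>c\<close> must satisfy
  \<open>\<Sum> 1 / c \<equiv> 6 (mod 7)\<close>. The choice \<open>c = 1, 45\<close> does, as \<open>1 / 45 \<equiv> 5 (mod 7)\<close>, and leaves
  \<open>6/7 - 1/7 - 1/315 = 32/45\<close> for numbers with the prime factors 3 and 5 alone. So \<open>A\<close> has to avoid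
  1 and 45, a property that \<open>7 A \<union> B\<close> inherits.
\<close>

lemma extendable_seven_fold:
  assumes A: "extendable n A"
    and B: "finite B" "prime_full {3, 5, 7} B" "recip_sum B = 6 / 7"
    and B7: "\<And>b. b \<in> B \<Longrightarrow> b > 0 \<and> b \<noteq> 1 \<and> b \<noteq> 45 \<and> (7 dvd b \<longrightarrow> b = 7 \<or> b = 315)"
  shows "extendable (7 * n + \<Sum>B) ((*) 7 ` A \<union> B)"
proof -
  have fin: "finite A" and pos: "\<And>a. a \<in> A \<Longrightarrow> a > 0" and sum: "\<Sum>A = n" and rec: "recip_sum A = 1"
    and full: "prime_full {3, 5, 7} A" and avoid: "1 \<notin> A" "45 \<notin> A"
    using A by (auto simp: extendable_def one_partition_def recip_sum_def)
  have disj: "(*) 7 ` A \<inter> B = {}"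
    using B7 avoid by fastforce
  have inj: "inj_on ((*) (7::nat)) A" by (auto intro: inj_onI)
  have "recip_sum ((*) 7 ` A) = recip_sum A / 7"
    using inj by (simp add: recip_sum_def sum.reindex sum_divide_distrib) (simp add: mult.commute)
  then have "recip_sum ((*) 7 ` A \<union> B) = 1"
    using fin B(1,3) disj rec by (simp add: recip_sum_def sum.union_disjoint)
  moreover have "\<Sum>((*) 7 ` A \<union> B) = 7 * n + \<Sum>B"
    using fin B(1) disj inj sum by (simp add: sum.union_disjoint sum.reindex flip: sum_distrib_left)
  moreover have "prime_full {3, 5, 7} ((*) 7 ` A \<union> B)"
  proof -
    have "prime_factors (7 * a) \<subseteq> {3, 5, 7}" if "a \<in> A" for a
    proof -
      have "prime_factors (7 * a) = {7} \<union> prime_factors a"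
        using pos[OF that] by (simp add: prime_factors_product prime_prime_factors)
      then show ?thesis using full that by (auto simp: prime_full_def)
    qed
    then show ?thesis using B(2) by (auto simp: prime_full_def)
  qed
  moreover have "a \<notin> (*) 7 ` A" if "\<not> 7 dvd a" for a
    using that by auto
  then have "1 \<notin> (*) 7 ` A" "45 \<notin> (*) 7 ` A"
    by simp_all
  then have "1 \<notin> (*) 7 ` A \<union> B" "45 \<notin> (*) 7 ` A \<union> B"
    using B7 by auto
  moreover have "finite ((*) 7 ` A \<union> B)" "\<forall>a\<in>(*) 7 ` A \<union> B. a > 0"
    using fin pos B(1) B7 by auto
  ultimately show ?thesis
    unfolding extendable_def one_partition_def recip_sum_def by blast
qed

lemma prime_factors_of_dvd_357:
  assumes "a dvd 3 ^ i * 5 ^ j * (7::nat) ^ k"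
  shows "prime_factors a \<subseteq> {3, 5, 7}"
proof
  fix p assume p: "p \<in> prime_factors a"
  then have "prime p" "p dvd 3 ^ i * 5 ^ j * 7 ^ k"
    using assms by (auto intro: dvd_trans)
  then have "p dvd 3 \<or> p dvd 5 \<or> p dvd 7"
    by (metis prime_dvd_mult_iff prime_dvd_power)
  moreover have "prime (3::nat)" "prime (5::nat)" "prime (7::nat)" by simp_all
  ultimately show "p \<in> {3, 5, 7}"
    using \<open>prime p\<close> by (metis insert_iff primes_dvd_imp_eq)
qed

text \<open>
  With \<open>n' \<equiv> 1 (mod 8)\<close>, the sums \<open>7 n' + \<Sum>B\<close> have to reach the seven residue classes modulo 56 that are 1
  modulo 8, by one set \<open>B\<close> for each class. Small sums \<open>\<Sum>B\<close> are preferable, since the largest one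
  determines how far explicit partitions are needed.
\<close>

definition completions :: "nat list list" where
  "completions = [
    [3,5,7,9,15,315], [3,5,7,9,25,81,135,225,315,405], [3,5,7,15,25,27,75,81,225,315,405,675],
    [3,5,7,9,27,75,125,243,315,405,1125,1215], [3,5,7,15,25,27,75,125,225,243,315,405,1125,1215],
    [3,5,7,9,27,75,135,225,315,405,675,2025], [3,5,7,9,25,81,135,315,375,405,625,5625]]"

definition completion_divisors :: "nat list" where
  "completion_divisors =
    [3, 5, 7, 9, 15, 25, 27, 75, 81, 125, 135, 225, 243, 315, 375, 405, 625, 675, 1125, 1215, 2025, 5625]"

lemma completion_divisors_table: "divisor_table 1063125 completion_divisors"
  by code_simp

lemma completions_recip:
  "all_have_cofactor_sum (cofactors 1063125 completion_divisors) 911250 completions"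
  by code_simp

lemma completion_divisors_avoid:
  "list_all (\<lambda>b. b > 0 \<and> b \<noteq> 1 \<and> b \<noteq> 45 \<and> (7 dvd b \<longrightarrow> b = 7 \<or> b = 315)) completion_divisors"
  by code_simp

lemma completions_sums: "map sum_list completions = [354, 1210, 1858, 3554, 3810, 3906, 7610]"
  by code_simp

lemma extendable_completion:
  assumes A: "extendable n A" and s: "s \<in> {354, 1210, 1858, 3554, 3810, 3906, 7610}"
  shows "\<exists>A'. extendable (7 * n + s) A'"
proof -
  have "s \<in> set (map sum_list completions)"
    unfolding completions_sums using s by simp
  then obtain xs where xs: "xs \<in> set completions" "s = sum_list xs" by auto
  have "cofactor_sum (cofactors 1063125 completion_divisors) xs = Some 911250"
    using completions_recip xs(1) by (simp add: all_have_cofactor_sum_def list_all_iff)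
  from cofactor_sum_correct[OF this completion_divisors_table]
  have X: "distinct xs" "set xs \<subseteq> set completion_divisors" "recip_sum (set xs) = 6 / 7"
    by auto
  have "prime_full {3, 5, 7} (set xs)"
    unfolding prime_full_def
  proof
    fix b assume "b \<in> set xs"
    with X(2) completion_divisors_table have "b dvd 3 ^ 5 * 5 ^ 4 * 7 ^ 1"
      by (auto simp: divisor_table_def list_all_iff)
    then show "prime_factors b \<subseteq> {3, 5, 7}" by (rule prime_factors_of_dvd_357)
  qed
  moreover have "b > 0 \<and> b \<noteq> 1 \<and> b \<noteq> 45 \<and> (7 dvd b \<longrightarrow> b = 7 \<or> b = 315)" if "b \<in> set xs" for b
    using completion_divisors_avoid that X(2) unfolding list_all_iff by blast
  ultimately have "extendable (7 * n + \<Sum>(set xs)) ((*) 7 ` A \<union> set xs)"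
    using A X(3) by (intro extendable_seven_fold) auto
  with X(1) xs(2) show ?thesis by (auto simp: distinct_sum_list_conv_Sum)
qed

text \<open>
  From \<open>7 * 3609 + 7610 = 32873\<close> on, every admissible \<open>s\<close> leaves \<open>n' \<ge> 3609\<close>.
\<close>

lemma descent_by_seven:
  fixes n :: nat
  assumes "n mod 8 = 1" "n \<ge> 32873"
  obtains n' s where "n = 7 * n' + s" "n' mod 8 = 1" "3609 \<le> n'" "n' < n"
    "s \<in> {354, 1210, 1858, 3554, 3810, 3906, 7610}"
proof -
  define m where "m = n div 8"
  define q j where "q = m div 7" and "j = m mod 7"
  have "n = 8 * m + 1"
    using assms(1) mult_div_mod_eq[of 8 n] by (simp add: m_def)
  moreover have "m = 7 * q + j"
    by (simp add: q_def j_def)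
  ultimately have n: "n = 56 * q + 8 * j + 1" by simp
  have j: "j < 7" by (simp add: j_def)
  have q: "q \<ge> 586" using n j assms(2) by linarith
  (* For n' = 8 p + 1 the equation n = 7 n' + s becomes q - p = (s + 6 - 8 j) / 56. *)
  consider "j = 0" | "j = 1" | "j = 2" | "j = 3" | "j = 4" | "j = 5" | "j = 6"
    using j by linarith
  then show thesis
  proof cases
    case 1
    then show thesis using that[of "8 * (q - 136) + 1" 7610] n q assms(2) by simp
  next
    case 2
    then show thesis using that[of "8 * (q - 68) + 1" 3810] n q assms(2) by simp
  next
    case 3
    then show thesis using that[of "8 * (q - 33) + 1" 1858] n q assms(2) by simp
  next
    case 4
    then show thesis using that[of "8 * (q - 6) + 1" 354] n q assms(2) by simp
  next
    case 5
    then show thesis using that[of "8 * (q - 63) + 1" 3554] n q assms(2) by simp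
  next
    case 6
    then show thesis using that[of "8 * (q - 21) + 1" 1210] n q assms(2) by simp
  next
    case 7
    then show thesis using that[of "8 * (q - 69) + 1" 3906] n q assms(2) by simp
  qed
qed


section \<open>Prime factors 3, 5 and 7: the range from 3609 to 32873\<close>

definition divisors_357 :: "nat list" where
  "divisors_357 =
    [3, 5, 7, 9, 15, 21, 25, 27, 35, 49, 63, 75, 81, 105, 125, 135, 147, 175, 189, 225, 243, 245, 315, 343, 375, 405,
    441, 525, 567, 675, 735, 875, 945, 1029, 1125, 1215, 1225, 1323, 1575, 1701, 1715, 2025, 2205, 2625, 2835, 3087,
    3375, 3675, 3969, 4725, 5145]"

definition grid357_1 :: grid where
  "grid357_1 = (
    [7, 15, 21, 25, 27, 35, 63, 75, 105, 125, 135, 147, 189, 225, 315, 525, 1125, 1225],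
    3406725,
   [
    [7,15,21,27,63,105,135], [7,15,21,25,63,105,225], [7,15,25,27,35,135,225], [7,21,25,27,35,63,135,225,315],
    [7,15,21,35,63,105,135,189,315], [7,15,25,27,63,105,135,225,315], [7,15,21,25,105,135,189,225,315],
    [7,15,21,27,63,135,225,315,525], [7,21,25,27,35,63,135,147,1225], [7,15,21,35,63,75,125,315,1125],
    [7,15,21,35,63,75,147,225,1225], [7,15,21,27,75,125,135,315,1125], [7,15,21,25,105,135,147,189,1225],
    [7,15,21,27,75,135,147,225,1225], [7,15,21,25,75,125,225,315,1125], [7,15,25,35,75,105,125,135,189,225,1125],
    [7,15,21,27,63,135,147,525,1225], [7,15,21,25,63,125,315,525,1125], [7,15,21,25,63,147,225,525,1225],
    [7,15,25,35,63,105,135,147,189,315,1225], [7,15,27,35,63,75,135,147,225,315,1225],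
    [7,15,25,35,63,105,125,135,189,525,1125], [7,15,27,35,63,75,125,135,225,525,1125],
    [7,15,21,35,75,135,147,189,225,315,1225], [7,21,25,35,63,75,105,125,135,189,225,315,1125],
    [7,15,21,35,75,125,135,189,225,525,1125], [7,15,21,35,75,105,125,225,315,525,1125],
    [7,15,21,35,63,135,147,189,315,525,1225], [7,15,25,27,63,135,147,225,315,525,1225],
    [7,15,21,25,75,125,147,1125,1225], [7,15,21,25,135,147,189,225,315,525,1225]],
   [
    [3,5,9,49,245,441,945,1323], [3,5,9,49,243,405,1215,1323], [3,5,9,81,175,243,375,567,875,1215],
    [3,5,9,49,245,441,735,2205], [3,5,9,81,175,245,405,441,945,1575], [3,5,9,49,175,945,1323,1575],
    [3,5,9,49,175,735,1575,2205], [3,5,9,81,245,375,405,441,675,735,875,1323], [3,5,9,49,245,405,735,3969],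
    [3,5,9,49,405,567,675,945,1323,1575], [3,5,9,81,243,245,441,567,735,945,1215,1323],
    [3,5,9,81,175,375,405,675,735,875,1323,1575], [3,5,9,49,375,567,675,875,1323,2835],
    [3,5,9,81,175,243,567,735,945,1215,1323,1575], [3,5,9,81,243,245,375,441,875,1215,1575,2025],
    [3,5,9,81,175,375,405,567,735,875,1323,2835], [3,5,9,49,405,441,735,945,1323,3969],
    [3,5,9,49,243,675,1215,1323,1575,2835], [3,5,9,49,405,441,675,945,1575,3969],
    [3,5,9,49,375,405,675,1323,2025,3375], [3,5,9,81,175,243,405,735,1215,1323,1575,2835],
    [3,5,9,49,245,735,945,1215,1701,3969], [3,5,9,81,175,243,375,675,1215,1575,2025,3375],
    [3,5,9,81,245,375,405,441,875,945,1215,1575,1701,2025], [3,5,9,81,175,375,405,441,735,875,2835,3969],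
    [3,5,9,175,243,245,375,405,441,567,675,875,945,1215,1575,2835],
    [3,5,9,81,175,375,567,735,875,945,1215,1323,1701,2835], [3,5,9,49,245,441,1323,2205,2835,3969],
    [3,5,9,81,243,245,375,875,945,1215,1323,1575,2025,2205]])"

definition grid357_2 :: grid where
  "grid357_2 = (
    [3, 9, 21, 25, 27, 35, 49, 63, 75, 125, 135, 147, 175, 245, 441, 735, 1125, 1225, 1323, 1575, 2205, 3675],
    5953500,
   [
    [3,9,21,27,63,75,135,175], [3,9,21,35,49,63,147,245,441,735], [3,9,21,25,49,63,441,1225],
    [3,9,25,27,35,75,135,1575], [3,9,21,27,35,135,175,1575], [3,9,27,35,49,75,135,147,175,245,441,735],
    [3,9,25,35,49,63,75,175,441,1225], [3,9,25,35,49,63,75,147,735,1575], [3,9,25,27,49,75,135,147,735,1575],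
    [3,9,21,35,49,75,125,135,1125,1323], [3,9,25,27,35,135,147,175,1225,1575], [3,9,21,35,49,63,135,175,1323,1575],
    [3,9,21,35,63,75,125,175,245,441,1125,1575], [3,9,21,25,63,75,125,1125,1225,2205],
    [3,9,21,35,49,75,125,245,441,735,1125,2205], [3,9,21,25,49,125,175,245,1125,3675],
    [3,9,21,27,63,125,135,147,441,1125,1575,2205], [3,9,27,35,63,75,125,135,147,175,441,1125,1575,2205],
    [3,9,21,35,63,75,135,147,245,441,1323,3675], [3,9,21,25,35,125,1125,1225,1575,2205],
    [3,9,25,27,49,75,135,245,441,735,1225,3675], [3,9,21,35,49,75,147,175,441,735,1575,3675],
    [3,9,25,35,49,75,125,135,245,441,1125,1225,1323,2205], [3,9,21,35,49,125,135,175,245,441,1125,1225,1323,2205],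
    [3,9,21,25,35,147,441,1225,1575,3675], [3,9,25,35,49,63,75,175,735,1225,1575,3675],
    [3,9,21,25,49,125,135,1125,1225,1323,1575,2205], [3,9,21,35,49,63,135,245,735,1323,1575,3675],
    [3,9,21,25,49,125,175,441,735,1125,2205,3675], [3,9,27,35,49,75,135,147,175,245,441,1575,2205,3675]],
   [
    [5,7,15,105,225,315,525], [5,7,15,105,189,405,567], [5,7,15,105,189,315,945], [5,7,15,81,315,405,945],
    [5,7,15,81,243,567,1215], [5,7,15,189,225,315,405,525,567], [5,7,15,189,225,243,405,525,1215],
    [5,7,15,105,375,405,567,675,875], [5,7,15,81,189,1215,1701], [5,7,15,105,315,375,675,875,945],
    [5,7,15,81,225,525,2835], [5,7,15,225,315,375,405,525,567,675,875], [5,7,15,81,189,945,2835],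
    [5,7,15,105,225,525,567,1215,1701], [5,7,15,189,315,375,405,567,675,875,945],
    [5,7,15,225,243,375,405,525,675,875,1215], [5,7,15,81,405,567,945,1215,1701],
    [5,7,15,189,243,375,405,675,875,945,1215], [5,7,15,105,225,525,567,945,2835], [5,7,15,105,243,405,567,1215,2835],
    [5,7,15,105,243,315,945,1215,2835], [5,7,15,189,225,315,525,567,945,1215,1701], [5,7,15,81,375,675,875,945,2835],
    [5,7,15,189,225,375,525,567,675,875,2835], [5,7,15,225,243,315,405,525,567,1215,2835],
    [5,7,15,105,189,405,1215,1701,2835], [5,7,15,105,375,567,675,875,945,1215,1701],
    [5,7,15,189,243,315,375,675,875,1215,2835], [5,7,15,189,225,315,405,525,1215,1701,2835],
    [5,7,15,225,315,375,525,567,675,875,945,1215,1701]])"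

definition grid357_3 :: grid where
  "grid357_3 = (
    [3, 5, 15, 21, 25, 27, 35, 81, 135, 175, 189, 225, 243, 315, 405, 567, 675, 945, 1215, 1701, 2025, 2835],
    7375725,
   [
    [3,5,15,21,25,135,189,225,315], [3,5,15,21,27,81,189,315,405], [3,5,21,25,27,35,135,189,225,405,567],
    [3,5,15,21,25,81,225,405,945], [3,5,15,21,35,81,175,189,225,405,675], [3,5,21,25,27,35,135,189,225,315,945],
    [3,5,15,21,35,81,135,189,315,405,945], [3,5,15,25,27,81,135,225,315,405,945],
    [3,5,15,21,27,135,175,225,405,567,675], [3,5,15,27,35,81,135,175,189,225,315,405,675],
    [3,5,15,21,35,81,135,189,243,567,1215], [3,5,15,21,27,135,175,225,315,675,945],
    [3,5,15,21,27,135,189,243,315,405,1215], [3,5,15,21,25,135,225,315,405,567,945],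
    [3,5,15,21,35,135,175,189,225,315,405,567,675], [3,5,21,25,27,35,135,175,189,405,2025],
    [3,5,15,21,25,135,225,243,405,945,1215], [3,5,15,21,35,81,135,189,225,567,2025],
    [3,5,15,21,35,135,175,189,225,243,405,675,1215], [3,5,15,25,27,81,135,175,315,567,2025],
    [3,5,15,21,27,81,135,315,2835], [3,5,15,21,25,81,225,315,2835], [3,5,15,25,27,81,135,189,225,1215,1701],
    [3,5,21,25,27,35,189,225,243,315,405,945,1215], [3,5,15,21,25,135,189,315,405,675,2025],
    [3,5,21,25,27,35,81,175,567,945,2025], [3,5,15,21,25,135,175,315,405,945,2025],
    [3,5,15,21,25,135,189,225,567,1215,1701]],
   [
    [7,9,49,105,147,735], [7,9,63,75,125,1125], [7,9,75,105,125,245,441,1125], [7,9,63,105,125,375,875,1125],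
    [7,9,49,105,245,525,735,1225], [7,9,49,63,735,2205], [7,9,49,105,245,441,735,2205],
    [7,9,75,125,147,245,441,525,1125,1225], [7,9,75,105,125,441,525,735,1125,1225],
    [7,9,49,125,375,441,525,875,1125,1225], [7,9,49,75,441,1125,1225,2625], [7,9,49,147,245,441,525,735,1225,2205],
    [7,9,49,125,245,525,735,875,1225,2625], [7,9,63,125,245,375,441,525,875,1125,1225,2205],
    [7,9,49,125,245,441,735,875,2205,2625], [7,9,49,105,375,525,735,875,1225,3675],
    [7,9,63,75,375,441,525,875,1575,3675], [7,9,63,75,245,441,1125,1225,2205,2625],
    [7,9,63,75,245,525,735,1575,1715,3087], [7,9,49,105,245,525,1225,1715,2205,3087],
    [7,9,63,105,245,375,441,875,1125,1225,2205,2625], [7,9,49,147,375,441,525,735,875,1575,1715,3087],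
    [7,9,49,125,375,525,735,875,1125,1225,1715,3087], [7,9,75,105,147,375,525,735,875,1575,2205,3675],
    [7,9,49,147,245,441,735,1125,1225,1575,2205,2625], [7,9,63,105,245,375,441,735,875,1715,3087,3675],
    [7,9,75,125,147,245,375,875,1125,1715,3087,3675], [7,9,105,125,147,245,375,441,735,875,1125,1575,2205,3675]])"

definition grid357_4 :: grid where
  "grid357_4 = (
    [5, 7, 81, 125, 135, 189, 243, 315, 375, 405, 441, 525, 567, 675, 875, 945, 1125, 1215, 1575, 2025, 2835, 3375,
    3675],
    3748500,
   [
    [5,7,135,189,315,945], [5,7,81,405,675,1575], [5,7,125,135,1125,1575], [5,7,135,375,405,567,675,875],
    [5,7,189,243,315,405,945,1215], [5,7,135,315,375,675,875,945], [5,7,125,375,405,567,875,1125],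
    [5,7,135,315,405,567,675,1575], [5,7,135,315,375,525,875,1575], [5,7,81,405,567,2835],
    [5,7,135,315,375,525,675,3375], [5,7,243,315,375,405,525,875,1215,1575], [5,7,135,243,315,945,1215,2835],
    [5,7,135,189,567,675,1575,2835], [5,7,189,315,375,441,675,875,1575,3675], [5,7,135,375,441,675,875,945,1575,3675],
    [5,7,135,375,405,567,875,1575,2025,2835], [5,7,125,405,441,675,945,1125,2025,3675],
    [5,7,315,375,405,441,567,675,875,945,1575,3675], [5,7,135,375,405,567,675,2025,2835,3375]],
   [
    [3,9,15,21,27,35,63], [3,9,15,21,25,27,225], [3,9,15,21,27,63,75,105,175], [3,9,15,25,27,35,75,175,225],
    [3,9,15,21,27,49,63,147,735], [3,9,15,27,35,49,63,75,147,175,735], [3,9,15,25,27,49,75,147,175,225,735],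
    [3,9,15,25,27,35,63,147,1225], [3,9,21,25,27,35,63,75,147,175,1225], [3,9,15,25,27,63,75,105,147,175,1225],
    [3,9,15,25,35,49,63,75,175,225,1323], [3,9,15,21,25,63,105,147,225,245,1323],
    [3,9,21,25,27,35,49,63,245,735,1225], [3,9,15,25,35,63,75,105,147,175,225,245,1323],
    [3,9,15,21,25,63,75,175,225,735,1323]])"

definition grid357_5 :: grid where
  "grid357_5 = (
    [5, 7, 9, 15, 21, 49, 63, 75, 135, 147, 189, 245, 315, 343, 405, 441, 567, 735, 945, 1029, 1323, 1715, 2835, 3087,
    3675, 3969, 5145],
    5986575,
   [
    [5,7,9,15,49,63,189,245,405,441,567,945,1323], [5,7,9,15,21,405,441,735,3969],
    [5,7,9,15,63,75,135,147,189,405,567,1323,3675], [5,7,9,15,63,75,135,147,189,315,945,1323,3675],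
    [5,7,9,15,49,63,189,245,315,405,735,945,3969], [5,7,9,15,49,63,147,245,405,441,945,1323,3969],
    [5,7,9,15,49,63,189,245,343,405,567,1029,5145], [5,7,9,15,63,75,147,189,245,405,441,567,945,1323,3675],
    [5,7,9,15,49,135,147,189,245,315,405,441,945,1323,3969], [5,7,9,15,49,75,135,147,441,567,735,2835,3675],
    [5,7,9,15,49,63,135,315,343,441,1029,1323,5145], [5,7,9,15,49,63,75,405,735,3675,3969],
    [5,7,9,15,49,63,135,245,315,567,1715,2835,3087], [5,7,9,21,49,63,75,135,147,315,441,567,735,2835,3675],
    [5,7,9,21,49,63,75,135,189,245,405,441,735,3675,3969], [5,7,9,21,49,63,75,147,189,245,315,405,945,3675,3969],
    [5,7,9,15,49,63,135,189,405,735,1715,3087,3969], [5,7,9,15,49,63,189,343,405,441,567,945,1029,1323,5145],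
    [5,7,9,21,49,63,75,135,147,245,315,1323,1715,3087,3675], [5,7,9,15,63,75,135,147,315,405,441,735,1323,3675,3969],
    [5,7,9,15,49,63,135,405,441,567,735,945,1323,2835,3969], [5,7,9,15,63,75,135,147,245,315,735,1323,1715,3087,3675],
    [5,7,9,15,49,63,135,245,567,735,945,1323,1715,2835,3087],
    [5,7,9,15,49,75,135,245,315,441,735,1323,1715,3087,3675],
    [5,7,9,15,49,135,147,189,245,315,343,405,1029,3969,5145],
    [5,7,9,15,63,75,135,245,315,405,441,567,735,945,1715,3087,3675],
    [5,7,9,15,63,75,135,147,245,315,567,1715,2835,3087,3675],
    [5,7,9,15,63,75,135,147,245,343,735,1029,1323,3675,5145],
    [5,7,9,15,49,63,189,245,315,441,735,1715,2835,3087,3969],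
    [5,7,9,15,49,63,135,315,343,735,1029,1323,1715,3087,5145],
    [5,7,9,21,49,63,75,147,189,245,315,567,1323,1715,2835,3087,3675],
    [5,7,9,15,49,135,147,189,315,343,405,441,945,1029,1323,3969,5145],
    [5,7,9,15,49,135,147,189,245,343,405,735,945,1029,1323,3969,5145],
    [5,7,9,15,63,75,135,189,245,441,567,735,945,1715,2835,3087,3675],
    [5,7,9,15,49,75,189,245,315,441,567,735,1323,1715,2835,3087,3675],
    [5,7,9,15,63,75,135,147,315,441,567,945,1323,1715,2835,3087,3675],
    [5,7,9,15,63,75,135,147,245,567,735,945,1323,1715,2835,3087,3675],
    [5,7,9,15,49,75,147,189,343,405,945,1029,3675,3969,5145],
    [5,7,9,21,49,63,75,147,189,315,343,405,945,1029,3675,3969,5145],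
    [5,7,9,15,49,75,147,189,245,441,1715,2835,3087,3675,3969],
    [5,7,9,15,49,75,135,147,405,567,1715,2835,3087,3675,3969],
    [5,7,9,15,49,63,245,343,405,441,567,735,945,1029,2835,3969,5145],
    [5,7,9,15,63,75,135,147,315,343,735,1029,1323,1715,3087,3675,5145],
    [5,7,9,21,49,63,75,135,315,343,405,441,567,945,1029,1715,3087,3675,5145],
    [5,7,9,15,49,63,189,343,405,441,735,945,1029,1715,3087,3969,5145],
    [5,7,9,21,49,63,75,147,189,245,343,441,1029,2835,3675,3969,5145],
    [5,7,9,21,49,63,75,135,189,343,441,735,945,1029,1323,1715,3087,3675,5145],
    [5,7,9,15,49,75,147,189,315,735,945,1323,1715,2835,3087,3675,3969],
    [5,7,9,15,63,75,135,147,315,343,567,1029,1715,2835,3087,3675,5145],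
    [5,7,9,15,63,75,147,189,343,405,567,735,945,1029,1323,1715,3087,3675,5145],
    [5,7,9,15,49,75,135,245,343,567,735,1029,1715,2835,3087,3675,5145],
    [5,7,9,15,49,75,135,315,343,441,735,945,1029,2835,3675,3969,5145],
    [5,7,9,21,49,63,75,147,245,343,405,441,567,945,1029,2835,3675,3969,5145],
    [5,7,9,21,49,63,135,147,189,245,343,405,441,735,945,1029,1323,1715,3087,3969,5145],
    [5,7,9,15,49,75,147,245,343,441,735,1029,1323,2835,3675,3969,5145],
    [5,7,9,21,49,75,135,147,189,245,315,343,405,441,567,945,1029,2835,3675,3969,5145],
    [5,7,9,15,49,75,147,245,343,405,735,1029,1715,3087,3675,3969,5145],
    [5,7,9,15,49,63,147,315,343,735,1029,1323,1715,2835,3087,3969,5145],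
    [5,7,9,15,63,75,135,189,343,441,567,735,945,1029,1715,2835,3087,3675,5145],
    [5,7,9,21,49,63,75,135,147,343,567,945,1029,1323,1715,2835,3087,3675,5145],
    [5,7,9,15,63,75,147,189,315,343,567,735,1029,1323,1715,2835,3087,3675,5145],
    [5,7,9,21,49,63,135,147,189,245,343,405,441,567,945,1029,1715,2835,3087,3969,5145],
    [5,7,9,15,49,75,189,315,343,441,567,735,1029,1323,1715,2835,3087,3675,5145],
    [5,7,9,15,63,75,135,147,343,567,735,945,1029,1323,1715,2835,3087,3675,5145],
    [5,7,9,15,63,135,147,189,245,343,405,441,567,735,945,1029,1715,2835,3087,3969,5145],
    [5,7,9,15,49,75,135,343,441,567,735,945,1029,1323,1715,2835,3087,3675,5145],
    [5,7,9,21,49,63,75,147,189,315,343,441,1029,1715,2835,3087,3675,3969,5145],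
    [5,7,9,15,63,75,135,245,315,343,405,567,1029,1715,2835,3087,3675,3969,5145]],
   [
    [3,25,35,105,175,225,375,875], [3,25,35,105,125,225,1125,1575], [3,25,35,105,125,225,875,2625],
    [3,25,35,125,175,225,375,875,1125,1575], [3,25,27,175,225,375,525,3375], [3,25,35,81,225,375,675,875,1215,1701],
    [3,27,35,81,125,375,875,1125,1215,1701], [3,25,35,81,175,525,675,1215,1575,1701],
    [3,25,35,105,175,225,525,1215,1701,2025], [3,25,35,105,125,375,875,1125,1225,2205],
    [3,25,35,125,175,225,375,675,1125,3375], [3,25,35,105,175,225,525,1125,1575,2625],
    [3,25,27,81,1215,1225,1701,2205], [3,25,35,105,175,225,675,875,1125,3375], [3,25,27,81,1125,1215,1701,2625],
    [3,25,27,105,375,675,875,4725], [3,25,27,125,225,525,2625,3375], [3,27,35,105,125,225,375,1125,1575,3375],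
    [3,27,35,81,105,525,1215,1225,1701,2205], [3,25,35,105,125,375,675,1125,1575,3375],
    [3,27,35,81,105,525,1125,1215,1701,2625], [3,27,35,105,125,225,525,675,1125,4725],
    [3,27,35,105,125,225,375,875,2625,3375], [3,25,35,81,105,1215,1701,4725], [3,25,27,125,175,1575,2625,3375],
    [3,25,35,105,125,375,675,875,2625,3375], [3,27,35,81,175,375,525,875,1215,1225,1701,2205],
    [3,27,35,105,125,175,525,1575,2625,3375], [3,25,35,105,175,375,525,875,1215,1575,1701,2025],
    [3,25,35,125,175,225,525,1125,1215,1575,1701,2025], [3,27,35,81,175,375,525,875,1125,1215,1701,2625],
    [3,27,35,125,175,225,375,525,675,875,1125,4725], [3,25,27,125,375,525,1125,1225,2205,3375],
    [3,25,27,175,225,375,1215,1701,2025,3375], [3,25,35,81,175,375,875,1215,1701,4725],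
    [3,25,35,105,175,375,525,875,1125,1225,2205,2625], [3,27,35,105,125,175,675,875,2625,4725],
    [3,25,35,81,225,525,675,1215,1225,1575,1701,2205], [3,25,27,125,375,525,875,1575,2625,3375],
    [3,25,35,125,175,225,525,875,1215,1701,2025,2625], [3,25,35,125,175,225,525,875,1225,1575,2205,2625],
    [3,27,35,81,175,375,525,675,1215,1575,1701,3375], [3,27,35,105,175,225,375,525,1215,1701,2025,3375],
    [3,25,35,81,225,525,675,1125,1215,1575,1701,2625], [3,27,35,81,125,525,1125,1215,1225,1575,1701,2205],
    [3,27,35,105,175,225,375,525,1225,1575,2205,3375], [3,25,27,175,225,525,675,1125,2625,4725],
    [3,27,35,105,125,375,525,675,875,1125,1575,4725], [3,25,35,105,175,375,525,675,1215,1701,2025,3375],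
    [3,25,35,105,175,375,525,675,1225,1575,2205,3375], [3,25,35,105,125,525,1125,1215,1225,1701,2025,2205],
    [3,25,35,105,125,375,525,1125,3375,4725], [3,25,27,105,375,1215,1575,1701,2025,3375],
    [3,25,35,105,175,225,1215,1225,1575,1701,2025,2205], [3,25,35,81,125,1125,1215,1575,1701,4725],
    [3,25,35,105,175,375,525,675,1125,1575,2625,3375], [3,27,35,81,125,525,875,1215,1225,1701,2205,2625],
    [3,27,35,105,175,225,375,675,875,1225,2205,4725], [3,25,35,105,125,525,875,1215,1575,1701,2025,2625],
    [3,27,35,105,175,225,375,675,875,1125,2625,4725], [3,25,27,105,525,675,1215,1701,2025,4725],
    [3,25,35,81,175,675,1125,1215,1225,1701,2205,2625], [3,25,35,125,175,225,525,675,1225,2205,2625,3375],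
    [3,25,27,125,225,1215,1701,2025,2625,3375], [3,25,35,81,125,875,1215,1701,2625,4725],
    [3,25,35,125,175,375,525,875,1125,1215,1225,1701,2025,2205], [3,27,35,81,105,375,1215,1701,3375,4725],
    [3,27,35,81,105,1125,1215,1225,1575,1701,2205,2625], [3,27,35,81,125,525,675,1215,1575,1701,2625,3375],
    [3,27,35,105,125,225,525,1215,1701,2025,2625,3375], [3,27,35,105,125,225,525,1225,1575,2205,2625,3375],
    [3,25,35,105,225,375,525,875,1215,1225,1575,1701,2025,2205]])"

definition grid357_6 :: grid where
  "grid357_6 = (
    [3, 5, 9, 21, 147, 245, 315, 405, 441, 525, 567, 735, 945, 1225, 1323, 1575, 2025, 2205, 3675, 3969, 4725],
    7342650,
   [
    [3,5,9,21,147,315,525,1225], [3,5,9,21,147,315,441,2205], [3,5,9,21,147,245,735,2205],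
    [3,5,9,21,245,315,441,735,945,1323], [3,5,9,21,147,315,405,3969], [3,5,9,21,245,315,441,525,1225,2205],
    [3,5,9,21,245,315,405,567,1323,2205], [3,5,9,21,147,441,735,945,1323,2205], [3,5,9,21,147,405,735,1225,1323,2025],
    [3,5,9,21,245,315,405,525,1225,3969], [3,5,9,21,245,405,441,525,567,4725], [3,5,9,21,245,315,441,525,945,4725],
    [3,5,9,21,147,405,735,945,1323,3969], [3,5,9,21,245,441,525,735,945,1225,1323,2205],
    [3,5,9,21,147,405,567,1323,1575,3675], [3,5,9,21,147,315,945,1323,1575,3675],
    [3,5,9,21,147,405,525,1323,2025,3675], [3,5,9,21,245,315,405,441,2025,4725],
    [3,5,9,21,147,405,525,1225,2205,3969], [3,5,9,21,245,405,441,735,1225,1323,2025,2205],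
    [3,5,9,21,147,315,735,1575,2205,3675], [3,5,9,21,147,315,945,1225,1575,4725],
    [3,5,9,21,147,441,525,945,2205,4725], [3,5,9,21,315,405,441,567,735,1323,1575,3675],
    [3,5,9,21,147,405,525,1225,2025,4725], [3,5,9,21,315,405,441,525,945,1225,1323,3969],
    [3,5,9,21,245,405,525,735,945,1225,1323,3969], [3,5,9,21,315,405,441,525,735,1323,2025,3675],
    [3,5,9,21,315,405,441,525,735,1225,2205,3969], [3,5,9,21,147,405,441,2025,2205,4725],
    [3,5,9,21,315,405,441,567,735,1225,1575,4725], [3,5,9,21,245,405,441,735,945,1323,2205,3969],
    [3,5,9,21,315,405,441,525,735,1225,2025,4725], [3,5,9,21,245,405,441,567,1323,1575,2205,3675],
    [3,5,9,21,245,315,525,735,1225,1575,2205,3675], [3,5,9,21,245,315,441,945,1323,1575,2205,3675],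
    [3,5,9,21,245,315,405,1225,1323,1575,2025,3675], [3,5,9,21,245,405,441,525,1323,2025,2205,3675],
    [3,5,9,21,245,405,525,567,945,1323,2205,4725], [3,5,9,21,245,405,441,567,1225,1575,2205,4725],
    [3,5,9,21,147,525,945,1225,1323,1575,2205,3675], [3,5,9,21,245,405,441,525,1225,2025,2205,4725],
    [3,5,9,21,245,315,405,945,1323,2025,2205,4725], [3,5,9,21,147,567,735,1225,1323,2025,2205,3969],
    [3,5,9,21,147,405,1225,1323,1575,2025,2205,3675], [3,5,9,21,245,315,405,945,1225,1575,3969,4725],
    [3,5,9,21,245,405,441,525,945,2205,3969,4725], [3,5,9,21,245,315,525,567,1225,2025,3969,4725]],
   [
    [7,15,27,63,81,125,175,225,1125,1215,1701], [7,15,25,75,81,125,189,225,1125,1215,1701],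
    [7,15,35,63,75,105,135,175,243,1215,2835], [7,25,27,35,63,75,105,189,675,1125,2625],
    [7,25,27,35,63,75,135,175,375,675,3375], [7,15,27,63,75,135,189,243,675,1215,2835],
    [7,15,35,75,81,105,125,175,225,675,1125,1215,1701], [7,15,25,75,105,125,175,189,375,1125,3375],
    [7,25,27,35,75,105,135,189,225,243,675,1215,2835], [7,15,25,105,125,135,175,189,225,375,675,1125,3375],
    [7,25,27,35,63,81,105,175,375,2835,3375], [7,15,27,75,81,105,175,225,375,2835,3375],
    [7,15,25,63,75,81,675,1125,1215,1701,2625], [7,25,27,35,63,81,175,189,225,675,1125,2625,2835],
    [7,15,27,35,135,225,243,375,1215,2835,3375], [7,25,27,35,63,105,135,175,243,375,1215,2835,3375],
    [7,25,27,35,63,75,175,189,243,1125,1215,2625,2835], [7,15,35,63,75,105,135,225,243,1125,1215,2625,2835],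
    [7,15,25,75,105,135,175,243,375,675,1215,2835,3375], [7,15,27,63,75,189,225,243,375,675,1215,2835,3375],
    [7,15,25,75,81,125,175,189,2625,2835,3375], [7,25,27,35,75,81,125,175,189,1215,1701,2625,3375],
    [7,15,25,75,81,105,125,675,2625,2835,3375], [7,15,35,63,105,125,135,175,243,375,675,1125,1215,2835,3375],
    [7,25,27,35,75,81,175,189,225,375,1125,1215,1701,2625,3375],
    [7,15,35,63,75,135,175,189,243,375,1125,1215,2625,2835,3375],
    [7,15,49,63,75,105,125,135,189,343,1029,1125,1715,3087,5145],
    [7,25,27,49,75,81,135,175,189,225,343,1029,1215,1701,1715,3087,5145],
    [7,15,27,49,63,225,343,375,1029,1715,3087,3375,5145],
    [7,25,27,49,75,81,105,125,225,343,1029,1125,1215,1701,1715,3087,5145],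
    [7,15,25,49,135,175,225,343,675,1029,1125,1715,2625,3087,5145],
    [7,15,35,49,105,175,189,225,243,343,675,1029,1215,1715,2835,3087,5145],
    [7,25,27,35,49,81,135,343,1029,1125,1715,2625,2835,3087,5145],
    [7,25,27,35,49,81,175,343,375,1029,1715,2835,3087,3375,5145],
    [7,25,27,49,63,75,81,189,343,675,1029,1125,1715,2625,2835,3087,5145],
    [7,25,35,49,63,75,81,135,189,343,675,1029,1125,1215,1701,1715,2625,3087,5145],
    [7,25,27,49,75,81,135,175,189,343,375,675,1029,1215,1701,1715,3087,3375,5145],
    [7,25,27,49,63,81,135,175,225,343,675,1029,1125,1215,1701,1715,2625,3087,5145],
    [7,25,35,49,75,81,105,135,175,189,343,375,675,1029,1715,2835,3087,3375,5145],
    [7,25,35,49,63,81,105,125,135,343,375,1029,1125,1215,1701,1715,3087,3375,5145],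
    [7,25,27,35,49,135,175,243,343,375,1029,1215,1715,2835,3087,3375,5145],
    [7,15,49,75,81,105,125,135,225,343,375,1029,1125,1215,1701,1715,3087,3375,5145],
    [7,15,35,49,75,135,189,343,375,675,1029,1125,1715,2625,3087,3375,5145],
    [7,15,49,63,75,135,175,189,225,243,343,375,1029,1215,1715,2835,3087,3375,5145],
    [7,15,49,63,75,105,135,225,243,343,375,675,1029,1215,1715,2835,3087,3375,5145],
    [7,27,35,49,75,81,105,125,135,189,225,343,1029,1715,2625,2835,3087,3375,5145],
    [7,25,35,49,75,105,125,135,175,189,243,343,375,1029,1125,1215,1715,2835,3087,3375,5145],
    [7,25,35,49,63,81,105,125,175,225,343,675,1029,1715,2625,2835,3087,3375,5145],
    [7,25,27,49,81,105,125,135,175,225,343,675,1029,1715,2625,2835,3087,3375,5145],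
    [7,15,35,49,81,105,189,343,375,1029,1125,1715,2625,2835,3087,3375,5145],
    [7,25,27,49,75,81,105,175,225,343,375,1029,1125,1715,2625,2835,3087,3375,5145],
    [7,15,49,63,75,81,135,189,343,375,675,1029,1125,1715,2625,2835,3087,3375,5145],
    [7,25,27,49,75,81,135,189,225,343,375,675,1029,1125,1215,1701,1715,2625,3087,3375,5145],
    [7,15,35,49,105,135,189,243,343,375,1029,1125,1215,1715,2625,2835,3087,3375,5145],
    [7,15,35,49,75,135,243,343,375,675,1029,1125,1215,1715,2625,2835,3087,3375,5145]])"

text \<open>
  Again the sums that the grids miss.
\<close>

definition single_357 :: grid where
  "single_357 = ([], 0, [[]],
   [
    [3,5,7,9,15,21,25,49,105,147,175,189,245,441,525,735,945], [3,5,7,9,15,21,27,35,63,135,315,405,567,735,1323],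
    [3,5,7,9,15,21,25,49,81,147,225,245,315,405,441,735,945],
    [3,5,7,9,15,21,35,49,75,81,147,175,243,315,567,735,1215], [3,5,7,9,15,21,25,35,105,175,189,245,405,441,2025],
    [3,5,7,9,15,21,27,35,75,135,175,405,567,675,1575], [3,5,7,9,15,21,25,75,81,105,147,189,225,405,525,675,1225],
    [3,5,7,9,15,25,27,35,63,75,189,375,735,875,1323], [3,5,7,9,15,21,35,49,63,75,147,245,315,441,675,735,945],
    [3,5,7,9,15,21,27,49,63,147,175,315,375,405,567,735,875],
    [3,5,7,9,15,21,25,49,125,135,147,189,245,441,525,735,1125],
    [3,5,7,9,21,25,35,49,63,75,105,147,175,189,225,245,315,405,441,567,735],
    [3,5,7,9,15,21,35,49,75,81,105,189,405,441,525,675,1225],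
    [3,5,7,9,15,27,35,49,63,75,105,147,175,189,675,735,1575],
    [3,5,7,9,15,21,25,49,105,125,147,245,315,441,525,735,1125],
    [3,5,7,9,15,21,25,75,81,105,147,175,245,405,441,945,1225],
    [3,5,7,15,21,25,27,35,49,63,75,81,105,135,147,175,225,243,567,735,1215],
    [3,5,7,9,15,21,25,63,75,125,175,189,245,441,525,945,1125], [3,5,7,9,15,21,25,35,75,189,245,405,441,525,2025],
    [3,5,7,9,15,21,35,63,75,105,135,175,189,315,375,405,567,675,875],
    [3,5,7,9,15,21,35,49,75,81,105,175,405,441,525,945,1225], [3,5,7,9,15,21,25,35,75,135,315,375,675,875,1575],
    [3,5,7,9,15,21,35,63,75,105,125,189,225,245,405,441,525,567,1125],
    [3,5,7,9,15,21,25,35,105,189,245,405,441,525,567,675,945],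
    [3,5,7,9,15,25,27,35,75,147,175,225,245,375,675,875,1323],
    [3,5,7,9,15,21,25,49,75,175,189,225,315,441,525,945,1225],
    [3,5,7,9,15,21,35,49,75,135,147,175,245,315,375,441,675,735,875],
    [3,5,7,9,15,25,27,35,63,147,225,245,315,375,675,875,1323],
    [3,5,7,9,15,25,35,49,63,75,105,125,189,441,945,1125,1225],
    [3,5,7,9,15,21,35,63,75,105,125,189,225,245,315,441,525,945,1125],
    [3,5,7,9,15,25,35,49,75,105,125,147,189,225,245,441,735,945,1125],
    [3,5,7,9,15,21,35,49,63,75,147,175,405,567,675,735,1575], [3,5,7,9,15,21,25,49,63,125,147,245,525,1125,2205],
    [3,5,7,9,21,25,35,49,63,75,105,125,147,189,225,245,405,441,567,735,1125],
    [3,5,7,9,15,25,35,49,75,105,125,135,189,225,315,441,525,1125,1225],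
    [3,5,7,9,15,21,35,49,63,75,147,175,375,525,735,875,1575],
    [3,5,7,9,15,21,25,75,105,147,175,189,225,245,315,441,525,945,1225],
    [3,5,7,9,15,25,35,49,63,75,147,175,243,315,405,525,675,735,1215],
    [3,5,7,9,15,21,25,35,105,125,225,245,441,875,2625],
    [3,5,7,9,15,21,35,49,75,135,147,175,189,315,375,675,735,875,945],
    [3,5,7,9,15,21,49,63,75,105,135,147,175,189,315,375,405,567,675,735,875],
    [3,5,7,9,15,21,35,49,81,105,147,175,243,315,375,567,735,875,1215],
    [3,5,7,9,15,21,25,49,63,125,225,375,441,525,875,1125,1225], [3,5,7,9,15,21,25,35,105,125,189,225,875,945,2625],
    [3,5,7,9,15,21,35,49,75,135,147,175,189,315,375,525,735,875,1575],
    [3,5,7,9,15,21,25,35,147,189,225,245,315,405,441,1225,2025],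
    [3,5,7,9,15,25,35,49,63,75,125,189,225,315,441,525,945,1125,1225],
    [3,5,7,9,15,21,35,49,63,105,147,175,375,405,567,675,735,875,1575],
    [3,5,7,15,21,25,27,35,49,63,75,81,147,175,189,225,243,245,375,441,567,675,735,875,1215],
    [3,5,7,9,15,21,35,49,63,75,147,315,375,525,567,735,875,1215,1701],
    [3,5,7,9,21,25,35,49,63,75,105,125,135,225,245,315,405,441,525,675,1125,1323,2025],
    [3,5,7,15,21,25,27,35,49,63,75,105,125,135,147,189,245,315,375,567,675,875,1125,1225,1715,2835,3087],
    [3,5,7,15,21,25,27,35,49,63,75,105,125,147,175,189,225,315,375,441,675,735,875,1575,2025,2625,2835,3375,3675],
    [3,5,7,15,21,25,27,35,49,63,75,105,125,147,175,189,315,375,405,441,675,735,875,1225,1575,1715,2025,2625,2835,3087,3375,3675,3969]])"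

definition grids_357 :: "grid list" where
  "grids_357 = [grid357_1, grid357_2, grid357_3, grid357_4, grid357_5, grid357_6, single_357]"

lemma divisor_table_357: "divisor_table 10418625 divisors_357"
  by code_simp

lemma divisors_357_avoid: "list_all (\<lambda>a. a \<noteq> 1 \<and> a \<noteq> 45) divisors_357"
  by code_simp

lemma grids_357_ok: "list_all (grid_ok 10418625 divisors_357) grids_357"
  by code_simp

lemma grids_357_cover: "covers_1_mod_8 451 4109 (grids_trie grids_357)"
  by code_simp

lemma extendable_base:
  assumes "n mod 8 = 1" "3609 \<le> n" "n < 32873"
  shows "\<exists>A. extendable n A"
proof (rule partition_from_grids[OF divisor_table_357 grids_357_ok grids_357_cover])
  show "n mod 8 = 1" "8 * 451 < n" "n \<le> 8 * 4109" "n > 1"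
    using assms by simp_all
next
  fix A assume A: "one_partition n A" "A \<subseteq> set divisors_357"
  have "prime_full {3, 5, 7} A"
    unfolding prime_full_def
  proof
    fix a assume "a \<in> A"
    with A(2) divisor_table_357 have "a dvd 3 ^ 5 * 5 ^ 3 * 7 ^ 3"
      by (auto simp: divisor_table_def list_all_iff)
    then show "prime_factors a \<subseteq> {3, 5, 7}" by (rule prime_factors_of_dvd_357)
  qed
  moreover have "1 \<notin> A" "45 \<notin> A"
    using A(2) divisors_357_avoid by (auto simp: list_all_iff)
  ultimately show ?thesis using A(1) by (auto simp: extendable_def)
qed

lemma extendable_exists:
  assumes "n mod 8 = 1" "3609 \<le> n"
  shows "\<exists>A. extendable n A"
  using assms
proof (induction n rule: less_induct)
  case (less n)
  show ?case
  proof (cases "n < 32873")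
    case True
    with less.prems show ?thesis by (rule extendable_base)
  next
    case False
    with less.prems obtain n' s where n': "n = 7 * n' + s" "n' mod 8 = 1" "3609 \<le> n'" "n' < n"
      and s: "s \<in> {354, 1210, 1858, 3554, 3810, 3906, 7610}"
      by (metis descent_by_seven not_less)
    from less.IH[OF n'(4,2,3)] obtain A where "extendable n' A" by blast
    from extendable_completion[OF this s] show ?thesis unfolding n'(1) .
  qed
qed

lemma prime_full_imp_two_free:
  assumes "prime_full P A" "2 \<notin> P" "0 \<notin> A"
  shows "two_free A"
  unfolding two_free_def
proof (intro ballI notI)
  fix a assume "a \<in> A" "2 dvd a"
  with assms(3) have "2 \<in> prime_factors a"
    by (intro prime_factorsI) (auto intro: ccontr)
  with assms(1,2) \<open>a \<in> A\<close> show False by (auto simp: prime_full_def)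
qed

theorem proposition4:
  fixes n :: nat
  assumes "n > 0" and "[n = 1] (mod 8)"
  shows "(n \<ge> 737 \<longrightarrow> (\<exists>A. one_partition n A \<and> two_free A)) \<and>
         (n \<ge> 3609 \<longrightarrow> (\<exists>A. one_partition n A \<and> prime_full {3, 5, 7} A))"
proof -
  have n: "n mod 8 = 1" using assms(2) by (simp add: cong_def)
  have large: "\<exists>A. one_partition n A \<and> prime_full {3, 5, 7} A" if "n \<ge> 3609"
    using extendable_exists[OF n that] by (auto simp: extendable_def)
  have "\<exists>A. one_partition n A \<and> two_free A" if "n \<ge> 737"
  proof (cases "n < 3609")
    case True
    with two_free_partition_below[OF n that] show ?thesis by blast
  next
    case False
    with large obtain A where A: "one_partition n A" "prime_full {3, 5, 7} A" by auto
    then have "0 \<notin> A" by (auto simp: one_partition_def)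
    with A show ?thesis using prime_full_imp_two_free[of "{3, 5, 7}" A] by auto
  qed
  with large show ?thesis by blast
qed

end
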